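(* Let $(\Omega_{N_n})_{n\in\mathbb{N}}$ be a sequence of networks obtained by the layered construction described in the context, with layer sizes $(a_i)_{i\ge 0}$ and $N_n=\sum_{i=0}^n a_i=\#\Omega_{N_n}$. Then $(\Omega_{N_n})_{n\in\mathbb{N}}$ is an SWD (small world based on the diameter) if and only if there exists $a>1$ such that $$\lim_{n\to\infty}\frac{n}{\log_a\left(\sum_{i=0}^n a_i\right)}\le 1 .$$ Moreover, this last inequality is always satisfied (for a given $a>1$) if $$\lim_{n\to\infty}\frac{a^n}{\sum_{i=0}^n a_i}\le 1 .$$
   Context: Layered construction. Start with $\omega_0=\{b\}$, a one-element set, $a_0=1$. For $n\ge 1$, take a finite set $\omega_n$ with $a_n>1$ elements, disjoint from the previous ones; each element of $\omega_n$ is linked (distance $1$) to at least one element of $\omega_{n-1}$. There are no other links (in particular none inside a layer $\omega_n$). Put $N_n=\sum_{i=0}^n a_i$ and $\Omega_{N_n}=\bigcup_{i=0}^n\omega_i$, regarded as a connected graph with these links; the distance $d(A,B)$ for $A,B\in\Omega_{N_n}$ is the length of a shortest path between $A$ and $B$. It is required that at each step $n\ge1$ there are two different elements of $\omega_n$ that are linked to two elements of $\omega_{n-1}$ having mutual distance $2(n-1)$, in such a way that $\Omega_{N_n}$ contains at least two elements at distance $2n$ (twice the number of performed steps). Let $d_{N_n}=\max\{d(A,B):A,B\in\Omega_{N_n}\}$. The sequence $(\Omega_{N_n})_n$ is an SWD if there is a finite constant $C\ge0$ such that $\lim_{n\to\infty}\frac{d_{N_n}}{\ln(N_n)}=C$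.
   Formalization: In the "Moreover" part, if a^n/N_n tends to 0 the limit of n/log_a(N_n) may fail to exist (N_n oscillating between about 4^n and 16^n, a=2); there limsup ≤ 1 is proved, and the limit statement is proved assuming that this limit exists. *)

theory Defs
  imports "Graph_Theory.Pair_Digraph" "HOL-Library.Extended_Real"
begin

text \<open>
  An undirected graph is a \<^type>\<open>pair_pre_digraph\<close> whose arc relation is symmetric. The distance is a
  natural number; it is meaningful only for vertices joined by a path, which is the case for
  every pair of vertices of the networks below, since these are connected.
\<close>

definition graph_dist :: "'a pair_pre_digraph \<Rightarrow> 'a \<Rightarrow> 'a \<Rightarrow> nat" where
  "graph_dist G u v = (LEAST k. \<exists>p. pre_digraph.apath (with_proj G) u p v \<and> length p = k)"

definition graph_diameter :: "'a pair_pre_digraph \<Rightarrow> nat" where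
  "graph_diameter G = Max {graph_dist G u v | u v. u \<in> pverts G \<and> v \<in> pverts G}"

definition SWD :: "(nat \<Rightarrow> 'a pair_pre_digraph) \<Rightarrow> bool" where
  "SWD G \<longleftrightarrow> (\<exists>C\<ge>0. (\<lambda>n. real (graph_diameter (G n)) / ln (real (card (pverts (G n)))))
      \<longlonglongrightarrow> C)"

text \<open>
  The network after step \<open>n\<close> is the subgraph induced on the first layers. In particular its
  distances only take into account paths that avoid all later layers: adding a layer may shorten
  distances between earlier elements.
\<close>

definition network :: "(nat \<Rightarrow> 'a set) \<Rightarrow> 'a rel \<Rightarrow> nat \<Rightarrow> 'a pair_pre_digraph" where
  "network \<omega> link n =
     \<lparr> pverts = (\<Union>i\<le>n. \<omega> i), parcs = link \<inter> ((\<Union>i\<le>n. \<omega> i) \<times> (\<Union>i\<le>n. \<omega> i)) \<rparr>"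

locale layered_construction =
  fixes b :: 'a and \<omega> :: "nat \<Rightarrow> 'a set" and link :: "'a rel" and a :: "nat \<Rightarrow> nat"
  assumes layer_0: "\<omega> 0 = {b}"
    and size_0: "a 0 = 1"
    and finite_layer: "n \<ge> 1 \<Longrightarrow> finite (\<omega> n)"
    and card_layer: "n \<ge> 1 \<Longrightarrow> card (\<omega> n) = a n"
    and size_gt_1: "n \<ge> 1 \<Longrightarrow> a n > 1"
    and disjoint_layers: "i < n \<Longrightarrow> \<omega> i \<inter> \<omega> n = {}"
    and sym_link: "sym link"
    and linked_to_previous: "n \<ge> 1 \<Longrightarrow> x \<in> \<omega> n \<Longrightarrow> \<exists>y\<in>\<omega> (n - 1). (x, y) \<in> link"
    and no_other_links: "(x, y) \<in> link \<Longrightarrow>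
      \<exists>n\<ge>1. (x \<in> \<omega> n \<and> y \<in> \<omega> (n - 1)) \<or> (x \<in> \<omega> (n - 1) \<and> y \<in> \<omega> n)"
    \<comment> \<open>\<open>A'\<close> and \<open>B'\<close> are at distance \<open>2 (n - 1)\<close> before the new layer is attached; for \<open>n = 1\<close>
      both are equal to \<open>b\<close>.\<close>
    and far_elements: "n \<ge> 1 \<Longrightarrow>
      \<exists>A\<in>\<omega> n. \<exists>B\<in>\<omega> n. \<exists>A'\<in>\<omega> (n - 1). \<exists>B'\<in>\<omega> (n - 1).
        A \<noteq> B \<and> (A, A') \<in> link \<and> (B, B') \<in> link \<and>
        graph_dist (network \<omega> link (n - 1)) A' B' = 2 * (n - 1)"
    and far_pair: "n \<ge> 1 \<Longrightarrow>
      \<exists>A\<in>pverts (network \<omega> link n). \<exists>B\<in>pverts (network \<omega> link n).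
        graph_dist (network \<omega> link n) A B = 2 * n"

end

theory Submission
  imports Defs
begin

text \<open>
  Every element of layer \<open>i\<close> is joined to \<open>b\<close> by a walk of length \<open>i\<close> descending through the layers, so
  the network after step \<open>n\<close> has diameter at most \<open>2 * n\<close>, and the required far pair makes this an
  equality. The small-world property thus only concerns the convergence of \<open>n / ln N\<close>, and
  \<open>log c N\<close> is \<open>ln N\<close> scaled by the free constant \<open>1 / ln c\<close>. If \<open>c ^ n / N\<close> tends to \<open>L > 0\<close>, then
  \<open>n * ln c - ln N\<close> is bounded and the quotient tends to \<open>1\<close>; if \<open>L = 0\<close>, then eventually
  \<open>c ^ n \<le> N\<close>, so the quotient is eventually at most \<open>1\<close>.
\<close>

text \<open>Cutting a cycle out of a walk only shortens it. This is needed because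
  \<open>graph_dist\<close> minimises over paths, whereas walks are easier to build.\<close>

lemma (in wf_digraph) awalk_imp_short_apath:
  assumes "awalk u p v"
  shows "\<exists>q. apath u q v \<and> length q \<le> length p"
  using assms
proof (induct rule: awalk_to_apath_induct)
  case (path p)
  then show ?case by (auto simp: apath_def)
next
  case (decomp p q r s)
  then have "length (q @ s) \<le> length p"
    by (auto elim!: awalk_cyc_decompE)
  with decomp(4) show ?case by (meson le_trans)
qed

lemma graph_dist_le_awalk:
  assumes "wf_digraph (with_proj G)" "pre_digraph.awalk (with_proj G) u p v"
  shows "graph_dist G u v \<le> length p"
proof -
  obtain q where "pre_digraph.apath (with_proj G) u q v" "length q \<le> length p"
    using wf_digraph.awalk_imp_short_apath[OF assms] by blast
  then show ?thesis
    unfolding graph_dist_def by (metis (mono_tags, lifting) Least_le le_trans)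
qed

context layered_construction
begin

lemma finite_layers: "finite (\<omega> i)"
  using layer_0 finite_layer[of i] by (cases "i = 0") auto

lemma card_network: "card (pverts (network \<omega> link n)) = (\<Sum>i\<le>n. a i)"
proof -
  have "\<omega> i \<inter> \<omega> j = {}" if "i \<noteq> j" for i j
    using disjoint_layers[of i j] disjoint_layers[of j i] that by (cases "i < j") auto
  moreover have "card (\<omega> i) = a i" for i
    using layer_0 size_0 card_layer[of i] by (cases "i = 0") auto
  ultimately show ?thesis
    by (simp add: network_def card_UN_disjoint finite_layers)
qed

lemma pair_sym_digraph_network: "pair_sym_digraph (network \<omega> link n)"
  by unfold_locales
    (use sym_link in \<open>auto simp: network_def symmetric_def sym_def\<close>)

lemma descending_awalk:
  assumes "x \<in> \<omega> i" "i \<le> n"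
  shows "\<exists>p. pre_digraph.awalk (with_proj (network \<omega> link n)) x p b \<and> length p = i"
  using assms
proof (induction i arbitrary: x)
  case 0
  interpret pair_sym_digraph "network \<omega> link n" by (rule pair_sym_digraph_network)
  from 0 layer_0 have "x = b" "b \<in> pverts (network \<omega> link n)"
    by (auto simp: network_def)
  then show ?case by (simp add: awalk_Nil_iff)
next
  case (Suc i)
  interpret pair_sym_digraph "network \<omega> link n" by (rule pair_sym_digraph_network)
  obtain y where y: "y \<in> \<omega> i" "(x, y) \<in> link"
    using linked_to_previous[of "Suc i" x] Suc.prems by auto
  with Suc obtain p where p: "awalk y p b" "length p = i" by auto
  have "(x, y) \<in> parcs (network \<omega> link n)"
    using y Suc.prems by (force simp: network_def)
  with p have "awalk x ((x, y) # p) b"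
    by (auto simp: awalk_Cons_iff dest: in_arcsD1)
  with p show ?case by (intro exI[of _ "(x, y) # p"]) simp
qed

lemma graph_dist_network_le:
  assumes "u \<in> pverts (network \<omega> link n)" "v \<in> pverts (network \<omega> link n)"
  shows "graph_dist (network \<omega> link n) u v \<le> 2 * n"
proof -
  interpret pair_sym_digraph "network \<omega> link n" by (rule pair_sym_digraph_network)
  have "\<exists>p. awalk x p b \<and> length p \<le> n" if "x \<in> pverts (network \<omega> link n)" for x
    using that descending_awalk[of x _ n] by (fastforce simp: network_def)
  with assms obtain p q where pq: "awalk u p b" "length p \<le> n" "awalk v q b" "length q \<le> n"
    by meson
  \<comment> \<open>The walk from \<open>u\<close> to \<open>v\<close> passes through
    \<open>b\<close>: descend from \<open>u\<close>, then run the descent from \<open>v\<close>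
    backwards, which the symmetry of the links allows.\<close>
  have "length (rev_path q) = length q" by (induct q) auto
  moreover have "awalk u (p @ rev_path q) v"
    using pq by (metis awalk_appendI awalk_rev_path)
  then have "graph_dist (network \<omega> link n) u v \<le> length (p @ rev_path q)"
    by (intro graph_dist_le_awalk wf_digraph_axioms)
  ultimately show ?thesis using pq by simp
qed

lemma graph_diameter_network: "graph_diameter (network \<omega> link n) = 2 * n"
proof -
  let ?G = "network \<omega> link n"
  let ?D = "{graph_dist ?G u v | u v. u \<in> pverts ?G \<and> v \<in> pverts ?G}"
  have bound: "d \<le> 2 * n" if "d \<in> ?D" for d
    using that graph_dist_network_le by auto
  then have "finite ?D" by (meson finite_nat_set_iff_bounded_le)
  moreover have "2 * n \<in> ?D"
  \<comment> \<open>\<open>far_pair\<close> speaks only of \<open>n \<ge> 1\<close>; for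
    \<open>n = 0\<close> the pair \<open>b\<close>, \<open>b\<close> attains the value 0.\<close>
  proof (cases "n = 0")
    case True
    have "b \<in> pverts ?G" using layer_0 by (auto simp: network_def)
    moreover from this have "graph_dist ?G b b = 2 * n"
      using graph_dist_network_le[of b n b] True by simp
    ultimately show ?thesis by force
  next
    case False
    then obtain A B where "A \<in> pverts ?G" "B \<in> pverts ?G" "graph_dist ?G A B = 2 * n"
      using far_pair[of n] by auto
    then show ?thesis by force
  qed
  ultimately show ?thesis
    unfolding graph_diameter_def using bound by (intro Max_eqI) auto
qed

text \<open>Linear growth is a crude bound, but it gives both that the sizes are at least 1 and that
  they tend to infinity.\<close>

lemma network_size_ge: "Suc n \<le> (\<Sum>i\<le>n. a i)"
proof (induction n)
  case (Suc n)
  then show ?case using size_gt_1[of "Suc n"] by simp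
qed (simp add: size_0)

lemma filterlim_network_size: "filterlim (\<lambda>n. real (\<Sum>i\<le>n. a i)) at_top sequentially"
proof (rule filterlim_at_top_mono[OF filterlim_real_sequentially])
  show "\<forall>\<^sub>F n in sequentially. real n \<le> real (\<Sum>i\<le>n. a i)"
    using network_size_ge by (auto intro!: always_eventually dest: Suc_leD simp del: of_nat_sum)
qed

end

lemma tendsto_div_log_iff:
  fixes S :: "nat \<Rightarrow> real"
  assumes "c > 1"
  shows "(\<lambda>n. real n / log c (S n)) \<longlonglongrightarrow> l \<longleftrightarrow> (\<lambda>n. real n / ln (S n)) \<longlonglongrightarrow> l / ln c"
proof -
  have "ln c \<noteq> 0" using assms by simp
  then show ?thesis
    using tendsto_mult_left_iff[of "ln c" "\<lambda>n. real n / ln (S n)" "l / ln c" sequentially]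
    by (simp add: log_def mult.commute)
qed

lemma converges_iff_log_quotient_le_1:
  fixes S :: "nat \<Rightarrow> real"
  assumes "\<And>n. S n \<ge> 1"
  shows "(\<exists>C\<ge>0. (\<lambda>n. 2 * real n / ln (S n)) \<longlonglongrightarrow> C) \<longleftrightarrow>
    (\<exists>c>1. \<exists>l\<le>1. (\<lambda>n. real n / log c (S n)) \<longlonglongrightarrow> l)" (is "?L \<longleftrightarrow> ?R")
proof
  assume ?L
  then obtain C where C: "C \<ge> 0" "(\<lambda>n. 2 * real n / ln (S n)) \<longlonglongrightarrow> C" by blast
  \<comment> \<open>With \<open>ln c = 2 / (C + 1)\<close> the new limit
    \<open>ln c * (C / 2)\<close> equals \<open>C / (C + 1)\<close>, which is below 1; the summand 1
    covers \<open>C = 0\<close>.\<close>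
  define c where "c = exp (2 / (C + 1))"
  have "c > 1" using C by (simp add: c_def)
  moreover have "ln c * (C / 2) \<le> 1" using C by (simp add: c_def field_simps)
  moreover have "(\<lambda>n. real n / ln (S n)) \<longlonglongrightarrow> C / 2"
    using tendsto_divide[OF C(2) tendsto_const[of 2]] by simp
  with \<open>c > 1\<close> have "(\<lambda>n. real n / log c (S n)) \<longlonglongrightarrow> ln c * (C / 2)"
    by (subst tendsto_div_log_iff) auto
  ultimately show ?R by blast
next
  assume ?R
  then obtain c l where "c > 1" "(\<lambda>n. real n / log c (S n)) \<longlonglongrightarrow> l" by blast
  then have "(\<lambda>n. real n / ln (S n)) \<longlonglongrightarrow> l / ln c"
    by (simp add: tendsto_div_log_iff)
  from tendsto_mult[OF tendsto_const[of 2] this]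
  have lim: "(\<lambda>n. 2 * real n / ln (S n)) \<longlonglongrightarrow> 2 * (l / ln c)" by simp
  \<comment> \<open>The sign of \<open>l\<close> is not given; it comes from the terms, which are
    nonnegative as \<open>S n \<ge> 1\<close> (a zero denominator yields the value 0).\<close>
  moreover have "2 * (l / ln c) \<ge> 0"
    using assms by (intro tendsto_lowerbound[OF lim]) (auto intro!: always_eventually)
  ultimately show ?L by blast
qed

text \<open>Since \<open>n * ln c = ln (c ^ n / S n) + ln (S n)\<close>, the quotient differs from 1
  by \<open>ln (c ^ n / S n) / ln (S n)\<close>, whose numerator converges (here
  \<open>L > 0\<close> matters) while its denominator diverges.\<close>

lemma log_quotient_tendsto_1:
  fixes S :: "nat \<Rightarrow> real"
  assumes "c > 1" "L > 0" and lim: "(\<lambda>n. c ^ n / S n) \<longlonglongrightarrow> L"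
    and S: "filterlim S at_top sequentially"
  shows "(\<lambda>n. real n / log c (S n)) \<longlonglongrightarrow> 1"
proof -
  have lnS: "filterlim (\<lambda>n. ln (S n)) at_top sequentially"
    using filterlim_compose[OF ln_at_top S] .
  have "(\<lambda>n. ln (c ^ n / S n)) \<longlonglongrightarrow> ln L"
    using lim \<open>L > 0\<close> by (intro tendsto_ln) auto
  then have "(\<lambda>n. ln (c ^ n / S n) / ln (S n)) \<longlonglongrightarrow> 0"
    using lnS by (intro real_tendsto_divide_at_top)
  then have "(\<lambda>n. ln (c ^ n / S n) / ln (S n) + 1) \<longlonglongrightarrow> 0 + 1"
    by (intro tendsto_intros)
  moreover have "\<forall>\<^sub>F n in sequentially. S n > 1"
    using S by (simp add: filterlim_at_top_dense)
  then have "\<forall>\<^sub>F n in sequentially. ln (c ^ n / S n) / ln (S n) + 1 = real n / log c (S n)"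
  proof eventually_elim
    case (elim n)
    with \<open>c > 1\<close> show ?case
      by (simp add: log_def ln_div ln_realpow field_simps)
  qed
  ultimately show ?thesis by (auto dest: Lim_transform_eventually)
qed

text \<open>Only a bound is available here: for \<open>L = 0\<close> the growth rate of
  \<open>S\<close> may oscillate above that of \<open>c ^ n\<close>, so the quotient need not
  converge.\<close>

lemma log_quotient_eventually_le_1:
  fixes S :: "nat \<Rightarrow> real"
  assumes "c > 1" "L < 1" and lim: "(\<lambda>n. c ^ n / S n) \<longlonglongrightarrow> L"
    and S: "filterlim S at_top sequentially"
  shows "\<forall>\<^sub>F n in sequentially. real n / log c (S n) \<le> 1"
proof -
  have "\<forall>\<^sub>F n in sequentially. S n > 1"
    using S by (simp add: filterlim_at_top_dense)
  moreover have "\<forall>\<^sub>F n in sequentially. c ^ n / S n < 1"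
    using order_tendstoD(2)[OF lim \<open>L < 1\<close>] .
  ultimately show ?thesis
  proof eventually_elim
    case (elim n)
    then have "c ^ n \<le> S n" by (simp add: field_simps)
    then have "log c (c ^ n) \<le> log c (S n)"
      using elim \<open>c > 1\<close> by (subst log_le_cancel_iff) auto
    then have "real n \<le> log c (S n)" using \<open>c > 1\<close> by simp
    moreover have "log c (S n) > 0" using elim \<open>c > 1\<close> by simp
    ultimately show ?case by simp
  qed
qed

text \<open>Because of this possible oscillation, the second part bounds the limit superior in every
  case and claims a limit only if \<open>L \<noteq> 0\<close> or the quotient is known to
  converge.\<close>

theorem theorem1:
  fixes b :: 'a and \<omega> :: "nat \<Rightarrow> 'a set" and link :: "'a rel" and a :: "nat \<Rightarrow> nat"
  assumes "layered_construction b \<omega> link a"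
  shows "(SWD (network \<omega> link) \<longleftrightarrow>
           (\<exists>c>1. \<exists>l\<le>1. (\<lambda>n. real n / log c (real (\<Sum>i\<le>n. a i))) \<longlonglongrightarrow> l)) \<and>
         (\<forall>c>1. \<forall>L\<le>1. (\<lambda>n. c ^ n / real (\<Sum>i\<le>n. a i)) \<longlonglongrightarrow> L \<longrightarrow>
           limsup (\<lambda>n. ereal (real n / log c (real (\<Sum>i\<le>n. a i)))) \<le> 1 \<and>
           (L \<noteq> 0 \<or> convergent (\<lambda>n. real n / log c (real (\<Sum>i\<le>n. a i))) \<longrightarrow>
             (\<exists>l\<le>1. (\<lambda>n. real n / log c (real (\<Sum>i\<le>n. a i))) \<longlonglongrightarrow> l)))"
proof (intro conjI allI impI)
  interpret layered_construction b \<omega> link a by fact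
  let ?S = "\<lambda>n. real (\<Sum>i\<le>n. a i)"
  have "?S n \<ge> 1" for n
    using network_size_ge[of n] by (simp del: of_nat_sum)
  note S = this filterlim_network_size
  show "SWD (network \<omega> link) \<longleftrightarrow> (\<exists>c>1. \<exists>l\<le>1. (\<lambda>n. real n / log c (?S n)) \<longlonglongrightarrow> l)"
    unfolding converges_iff_log_quotient_le_1[of ?S, OF S(1), symmetric]
    by (simp add: SWD_def graph_diameter_network card_network)
  fix c L :: real
  assume c: "c > 1" and L: "L \<le> 1" and lim: "(\<lambda>n. c ^ n / ?S n) \<longlonglongrightarrow> L"
  let ?q = "\<lambda>n. real n / log c (?S n)"
  \<comment> \<open>Nonnegative terms have a nonnegative limit, so \<open>L \<noteq> 0\<close>
    amounts to \<open>L > 0\<close> and the two preceding lemmas cover all cases.\<close>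
  have "L \<ge> 0"
    using c by (intro tendsto_lowerbound[OF lim]) (simp_all del: of_nat_sum)
  have to_1: "?q \<longlonglongrightarrow> 1" if "L \<noteq> 0"
    using log_quotient_tendsto_1[OF c _ lim S(2)] that \<open>L \<ge> 0\<close> by simp
  have le_1: "\<forall>\<^sub>F n in sequentially. ?q n \<le> 1" if "L = 0"
    using log_quotient_eventually_le_1[OF c _ lim S(2)] that by simp
  show "limsup (\<lambda>n. ereal (?q n)) \<le> 1"
  proof (cases "L = 0")
    case True
    from le_1[OF this] show ?thesis
      by (intro Limsup_bounded) (simp add: one_ereal_def del: of_nat_sum)
  next
    case False
    then have "(\<lambda>n. ereal (?q n)) \<longlonglongrightarrow> ereal 1"
      using to_1 by (intro tendsto_ereal)
    from lim_imp_Limsup[OF trivial_limit_sequentially this] show ?thesis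
      by (simp add: one_ereal_def del: of_nat_sum)
  qed
  assume "L \<noteq> 0 \<or> convergent ?q"
  then show "\<exists>l\<le>1. ?q \<longlonglongrightarrow> l"
  proof (cases "L = 0")
    case True
    with \<open>L \<noteq> 0 \<or> convergent ?q\<close> obtain l where "?q \<longlonglongrightarrow> l" by (auto simp: convergent_def)
    moreover from this have "l \<le> 1"
      using le_1[OF True] by (intro tendsto_upperbound[of ?q]) auto
    ultimately show ?thesis by blast
  next
    case False
    then show ?thesis using to_1 by blast
  qed
qed

end
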